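(* For odd $n\geq 3$, let $\mathrm{Dic}_n=\langle a,x \mid a^{2n}=e,\ x^2=a^n,\ x^{-1}ax=a^{-1}\rangle$ be the dicyclic group of order $4n$. Then Player 1 has a winning strategy for $\texttt{REL}(\mathrm{Dic}_n,\{a,x\})$.
   Context: Game $\texttt{REL}(G,S)$: $G$ is a finite group and $S$ a generating set with $e\notin S$. Two players alternate turns, Player 1 first, starting from the empty word $w_0$. On turn $n$ the current player chooses $s_n\in S\cup S^{-1}$, subject to $s_n\neq s_{n-1}^{-1}$ when $n>1$, and forms $w_n=w_{n-1}s_n$. If $w_n$ represents the same element of $G$ as some $w_k$ with $0\le k<n$, the player who formed $w_n$ wins. If a player has no legal move, that player loses. *)

theory Defs
  imports "HOL-Algebra.Group"
begin

section \<open>Groups given by generators and relations\<close>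

datatype 'g letter = Gen 'g | GenInv 'g

text \<open>The least congruence on words over the generators and their formal inverses that contains
  free cancellation and identifies the two sides of every relation.\<close>

inductive pres_eq :: "('g letter list \<times> 'g letter list) set \<Rightarrow> 'g letter list \<Rightarrow> 'g letter list \<Rightarrow> bool"
  for R where
  relation: "(u, v) \<in> R \<Longrightarrow> pres_eq R u v"
| cancel_right: "pres_eq R [Gen g, GenInv g] []"
| cancel_left: "pres_eq R [GenInv g, Gen g] []"
| refl: "pres_eq R u u"
| sym: "pres_eq R u v \<Longrightarrow> pres_eq R v u"
| trans: "pres_eq R u v \<Longrightarrow> pres_eq R v w \<Longrightarrow> pres_eq R u w"
| append: "pres_eq R u u' \<Longrightarrow> pres_eq R v v' \<Longrightarrow> pres_eq R (u @ v) (u' @ v')"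

definition pres_class ::
  "('g letter list \<times> 'g letter list) set \<Rightarrow> 'g letter list \<Rightarrow> 'g letter list set" where
  "pres_class R u = {v. pres_eq R u v}"

text \<open>The set of generators is the whole type \<open>'g\<close>.\<close>

definition presented_group ::
  "('g letter list \<times> 'g letter list) set \<Rightarrow> 'g letter list set monoid" where
  "presented_group R =
     \<lparr>carrier = range (pres_class R),
      mult = (\<lambda>A B. {w. \<exists>u\<in>A. \<exists>v\<in>B. pres_eq R (u @ v) w}),
      one = pres_class R []\<rparr>"

lemma pres_class_eq_iff: "pres_class R u = pres_class R v \<longleftrightarrow> pres_eq R u v"
  unfolding pres_class_def using pres_eq.refl pres_eq.sym pres_eq.trans by blast

lemma presented_group_mult:
  "pres_class R u \<otimes>\<^bsub>presented_group R\<^esub> pres_class R v = pres_class R (u @ v)"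
  unfolding presented_group_def pres_class_def
  by (auto intro: pres_eq.refl pres_eq.sym pres_eq.trans pres_eq.append)

fun formal_inverse :: "'g letter \<Rightarrow> 'g letter" where
  "formal_inverse (Gen g) = GenInv g"
| "formal_inverse (GenInv g) = Gen g"

lemma pres_eq_inverse: "pres_eq R (rev (map formal_inverse u) @ u) []"
proof (induction u)
  case Nil
  show ?case by (simp add: pres_eq.refl)
next
  case (Cons l u)
  have l: "pres_eq R [formal_inverse l, l] []"
    by (cases l) (auto intro: pres_eq.cancel_left pres_eq.cancel_right)
  have "pres_eq R (rev (map formal_inverse u) @ [formal_inverse l, l] @ u)
      (rev (map formal_inverse u) @ [] @ u)"
    by (intro pres_eq.append pres_eq.refl l)
  then show ?case
    using Cons.IH pres_eq.trans by fastforce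
qed

lemma group_presented_group: "group (presented_group R)"
proof (rule groupI)
  fix A B assume "A \<in> carrier (presented_group R)" "B \<in> carrier (presented_group R)"
  then obtain u v where "A = pres_class R u" "B = pres_class R v"
    by (auto simp: presented_group_def)
  then show "A \<otimes>\<^bsub>presented_group R\<^esub> B \<in> carrier (presented_group R)"
    by (auto simp: presented_group_mult) (simp add: presented_group_def)
next
  show "\<one>\<^bsub>presented_group R\<^esub> \<in> carrier (presented_group R)"
    by (simp add: presented_group_def)
next
  fix A B C
  assume "A \<in> carrier (presented_group R)" "B \<in> carrier (presented_group R)"
    "C \<in> carrier (presented_group R)"
  then obtain u v w where "A = pres_class R u" "B = pres_class R v" "C = pres_class R w"
    by (auto simp: presented_group_def)
  then show "A \<otimes>\<^bsub>presented_group R\<^esub> B \<otimes>\<^bsub>presented_group R\<^esub> C =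
      A \<otimes>\<^bsub>presented_group R\<^esub> (B \<otimes>\<^bsub>presented_group R\<^esub> C)"
    by (simp add: presented_group_mult)
next
  fix A assume "A \<in> carrier (presented_group R)"
  then obtain u where u: "A = pres_class R u"
    by (auto simp: presented_group_def)
  have one: "\<one>\<^bsub>presented_group R\<^esub> = pres_class R []"
    by (simp add: presented_group_def)
  show "\<one>\<^bsub>presented_group R\<^esub> \<otimes>\<^bsub>presented_group R\<^esub> A = A"
    by (simp add: u one presented_group_mult)
  have "pres_class R (rev (map formal_inverse u)) \<otimes>\<^bsub>presented_group R\<^esub> A =
      \<one>\<^bsub>presented_group R\<^esub>"
    by (simp add: u one presented_group_mult pres_class_eq_iff pres_eq_inverse)
  moreover have "pres_class R (rev (map formal_inverse u)) \<in> carrier (presented_group R)"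
    by (simp add: presented_group_def)
  ultimately show "\<exists>B\<in>carrier (presented_group R).
      B \<otimes>\<^bsub>presented_group R\<^esub> A = \<one>\<^bsub>presented_group R\<^esub>"
    by blast
qed


section \<open>The dicyclic group\<close>

datatype dic_gen = DicA | DicX

definition dic_relations :: "nat \<Rightarrow> (dic_gen letter list \<times> dic_gen letter list) set" where
  "dic_relations n =
     {(replicate (2 * n) (Gen DicA), []),
      ([Gen DicX, Gen DicX], replicate n (Gen DicA)),
      ([GenInv DicX, Gen DicA, Gen DicX], [GenInv DicA])}"

definition Dic :: "nat \<Rightarrow> dic_gen letter list set monoid" where
  "Dic n = presented_group (dic_relations n)"

definition dic_a :: "nat \<Rightarrow> dic_gen letter list set" where
  "dic_a n = pres_class (dic_relations n) [Gen DicA]"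

definition dic_x :: "nat \<Rightarrow> dic_gen letter list set" where
  "dic_x n = pres_class (dic_relations n) [Gen DicX]"


section \<open>The game REL(G, S)\<close>

text \<open>A position is the word formed so far, as the list of the elements of \<open>S \<union> S\<inverse>\<close> chosen;
  \<open>w\<^sub>k\<close> is its prefix of length \<open>k\<close>.\<close>

datatype player = Player1 | Player2

fun opponent :: "player \<Rightarrow> player" where
  "opponent Player1 = Player2"
| "opponent Player2 = Player1"

definition to_move :: "'a list \<Rightarrow> player" where
  "to_move w = (if even (length w) then Player1 else Player2)"

definition word_value :: "('a, 'b) monoid_scheme \<Rightarrow> 'a list \<Rightarrow> 'a" where
  "word_value G w = foldr (\<lambda>s g. s \<otimes>\<^bsub>G\<^esub> g) w \<one>\<^bsub>G\<^esub>"

definition rel_returns :: "('a, 'b) monoid_scheme \<Rightarrow> 'a list \<Rightarrow> bool" where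
  "rel_returns G w \<longleftrightarrow> (\<exists>k<length w. word_value G w = word_value G (take k w))"

definition rel_legal :: "('a, 'b) monoid_scheme \<Rightarrow> 'a set \<Rightarrow> 'a list \<Rightarrow> 'a set" where
  "rel_legal G S w =
     {s \<in> S \<union> (\<lambda>t. inv\<^bsub>G\<^esub> t) ` S. w \<noteq> [] \<longrightarrow> s \<noteq> inv\<^bsub>G\<^esub> (last w)}"

definition rel_over :: "('a, 'b) monoid_scheme \<Rightarrow> 'a set \<Rightarrow> 'a list \<Rightarrow> bool" where
  "rel_over G S w \<longleftrightarrow> rel_returns G w \<or> rel_legal G S w = {}"

text \<open>Only meaningful when the game is over at \<open>w\<close>.  If \<open>w\<close> returns to an earlier element, the
  player who formed \<open>w\<close> wins, i.e. the opponent of the player who would be next; otherwise the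
  player to move has no legal move and the opponent wins.\<close>

definition rel_winner :: "'a list \<Rightarrow> player" where
  "rel_winner w = opponent (to_move w)"

definition rel_play :: "('a, 'b) monoid_scheme \<Rightarrow> 'a set \<Rightarrow> 'a list \<Rightarrow> bool" where
  "rel_play G S w \<longleftrightarrow>
     (\<forall>k<length w. \<not> rel_over G S (take k w) \<and> w ! k \<in> rel_legal G S (take k w))"

definition follows_strategy :: "player \<Rightarrow> ('a list \<Rightarrow> 'a) \<Rightarrow> 'a list \<Rightarrow> bool" where
  "follows_strategy p \<sigma> w \<longleftrightarrow>
     (\<forall>k<length w. to_move (take k w) = p \<longrightarrow> w ! k = \<sigma> (take k w))"

text \<open>The last clause excludes never-ending plays; it holds automatically when \<open>G\<close> is finite.\<close>

definition winning_strategy ::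
  "('a, 'b) monoid_scheme \<Rightarrow> 'a set \<Rightarrow> player \<Rightarrow> ('a list \<Rightarrow> 'a) \<Rightarrow> bool" where
  "winning_strategy G S p \<sigma> \<longleftrightarrow>
     (\<forall>w. rel_play G S w \<and> follows_strategy p \<sigma> w \<longrightarrow>
        (rel_over G S w \<longrightarrow> rel_winner w = p) \<and>
        (\<not> rel_over G S w \<and> to_move w = p \<longrightarrow> \<sigma> w \<in> rel_legal G S w)) \<and>
     \<not> (\<exists>f :: nat \<Rightarrow> 'a. \<forall>m. rel_play G S (map f [0..<m]) \<and>
                               follows_strategy p \<sigma> (map f [0..<m]))"

definition has_winning_strategy ::
  "('a, 'b) monoid_scheme \<Rightarrow> 'a set \<Rightarrow> player \<Rightarrow> bool" where
  "has_winning_strategy G S p \<longleftrightarrow> (\<exists>\<sigma>. winning_strategy G S p \<sigma>)"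

end

theory Submission
  imports Defs
begin

text \<open>In the Cayley graph every coset \<open>{a\<^sup>c, a\<^sup>c x, a\<^sup>c x\<^sup>2, a\<^sup>c x\<^sup>3}\<close>, where \<open>c < n\<close>, is a 4-cycle
  (a column) with two vertices in the layer \<open>\<langle>a\<rangle>\<close> and two in the layer \<open>\<langle>a\<rangle>x\<close>; consecutive columns
  are joined within the layers.  Player 1 always steps to the next column in the current layer.
  Every round then advances by two columns, or by one column and a change of layer made by
  Player 2, so Player 1 moves from even columns in \<open>\<langle>a\<rangle>\<close> and from odd columns in \<open>\<langle>a\<rangle>x\<close>.  Since \<open>n\<close> is
  odd, either Player 1 is to move in column \<open>n - 1\<close> in \<open>\<langle>a\<rangle>\<close>, where a change of layer leaves Player 2
  without a safe reply, or Player 1 steps into column \<open>n - 1\<close> in \<open>\<langle>a\<rangle>x\<close>.  There the only reply that can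
  be safe changes to \<open>\<langle>a\<rangle>\<close>; Player 1 changes back to the other vertex of \<open>\<langle>a\<rangle>x\<close>, and play is forced
  backwards, parallel to the vertices already visited, down to the column of the previous change
  of layer.  The parity of that column makes Player 2 run out of safe moves first.\<close>


section \<open>Winning positions on a graph\<close>

text \<open>\<open>V\<close> is the set of visited vertices, \<open>p\<close> the previous vertex, which may not be
  re-entered, and \<open>c\<close> the current vertex.\<close>

inductive mover_wins :: "('v \<Rightarrow> 'v set) \<Rightarrow> 'v set \<Rightarrow> 'v \<Rightarrow> 'v \<Rightarrow> bool"
  for nb where
  close: "v \<in> nb c \<Longrightarrow> v \<noteq> p \<Longrightarrow> v \<in> V \<Longrightarrow> mover_wins nb V p c"
| advance: "v \<in> nb c \<Longrightarrow> v \<noteq> p \<Longrightarrow>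
    (\<And>u. u \<in> nb v \<Longrightarrow> u \<noteq> c \<Longrightarrow> u \<notin> insert v V) \<Longrightarrow>
    (\<And>u. u \<in> nb v \<Longrightarrow> u \<noteq> c \<Longrightarrow> mover_wins nb (insert u (insert v V)) v u) \<Longrightarrow>
    mover_wins nb V p c"

definition visited :: "('a, 'b) monoid_scheme \<Rightarrow> ('a \<Rightarrow> 'v) \<Rightarrow> 'a list \<Rightarrow> 'v set" where
  "visited G \<phi> w = (\<lambda>k. \<phi> (word_value G (take k w))) ` {..length w}"

lemma visited_snoc:
  "visited G \<phi> (w @ [s]) = insert (\<phi> (word_value G (w @ [s]))) (visited G \<phi> w)"
  unfolding visited_def by (force simp: atMost_Suc)

section \<open>From winning positions on the Cayley graph to strategies in
  \<open>REL\<close>\<close>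

context group
begin

lemma word_value_closed:
  "set w \<subseteq> carrier G \<Longrightarrow> word_value G w \<in> carrier G"
  by (induction w) (auto simp: word_value_def)

lemma word_value_snoc:
  "set w \<subseteq> carrier G \<Longrightarrow> s \<in> carrier G \<Longrightarrow>
    word_value G (w @ [s]) = word_value G w \<otimes> s"
proof (induction w)
  case Nil
  then show ?case by (simp add: word_value_def)
next
  case (Cons t w)
  then show ?case
    using word_value_closed[of w] by (simp add: word_value_def m_assoc)
qed

lemma rel_returns_snoc_iff:
  assumes "inj_on \<phi> (carrier G)" "set w \<subseteq> carrier G" "s \<in> carrier G"
  shows "rel_returns G (w @ [s]) \<longleftrightarrow> \<phi> (word_value G (w @ [s])) \<in> visited G \<phi> w"
proof -
  have c: "word_value G (take k (w @ [s])) \<in> carrier G" for k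
    using assms(2,3) set_take_subset[of k "w @ [s]"] by (intro word_value_closed) auto
  have "rel_returns G (w @ [s]) \<longleftrightarrow>
      (\<exists>k\<le>length w. \<phi> (word_value G (w @ [s])) = \<phi> (word_value G (take k (w @ [s]))))"
    unfolding rel_returns_def
    using inj_on_eq_iff[OF assms(1) c[of "Suc (length w)"] c] by (auto simp: less_Suc_eq_le)
  then show ?thesis
    by (auto simp: visited_def)
qed

text \<open>As long as play is not over all prefixes have distinct values, so an endless play would
  embed the naturals into the finite carrier.\<close>

lemma infinite_play_impossible:
  assumes "finite (carrier G)" "S \<subseteq> carrier G"
  shows "\<not> (\<forall>m. rel_play G S (map f [0..<m]))"
proof
  assume play: "\<forall>m. rel_play G S (map f [0..<m])"
  define g where "g m = word_value G (map f [0..<m])" for m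
  have prefix: "take k (map f [0..<m]) = map f [0..<k]" if "k \<le> m" for k m
    using that by (simp add: take_map)
  have step: "\<not> rel_over G S (map f [0..<m]) \<and> f m \<in> rel_legal G S (map f [0..<m])" for m
    using play[rule_format, of "Suc m"] prefix[of m "Suc m"]
    unfolding rel_play_def by (auto simp: nth_append)
  have "f m \<in> carrier G" for m
    using step[of m] assms(2) by (auto simp: rel_legal_def)
  then have "range g \<subseteq> carrier G"
    unfolding g_def by (auto intro!: word_value_closed)
  moreover have "inj g"
  proof (rule linorder_injI)
    fix k m :: nat assume "k < m"
    then show "g k \<noteq> g m"
      using step[of m] prefix[of k m] unfolding rel_over_def rel_returns_def g_def by force
  qed
  ultimately show False
    using assms(1) finite_subset finite_imageD infinite_UNIV_nat by blast
qed

text \<open>Player 1 picks any \<open>good\<close> move by choice. The invariant after each complete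
  round is that the last move did not return and that \<open>mover_wins\<close> holds for the
  labelled position.\<close>

lemma has_winning_strategy_Player1I:
  assumes fin: "finite (carrier G)" and S: "S \<subseteq> carrier G" and one: "\<one> \<notin> S"
    and inj: "inj_on \<phi> (carrier G)"
    and nb: "\<And>g. g \<in> carrier G \<Longrightarrow> nb (\<phi> g) = (\<lambda>s. \<phi> (g \<otimes> s)) ` (S \<union> (\<lambda>t. inv t) ` S)"
    and wins: "mover_wins nb {\<phi> \<one>} (\<phi> \<one>) (\<phi> \<one>)"
  shows "has_winning_strategy G S Player1"
proof -
  define T where "T = S \<union> (\<lambda>t. inv t) ` S"
  have T: "T \<subseteq> carrier G"
    using S unfolding T_def by auto
  define cur where "cur w = \<phi> (word_value G w)" for w
  define F where "F w \<longleftrightarrow> mover_wins nb (visited G \<phi> w) (cur (butlast w)) (cur w)" for w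
  define good where "good w s \<longleftrightarrow> s \<in> rel_legal G S w \<and>
    (rel_returns G (w @ [s]) \<or>
     (\<forall>t\<in>rel_legal G S (w @ [s]). \<not> rel_returns G (w @ [s, t]) \<and> F (w @ [s, t])))" for w s
  have legal_T: "s \<in> T" if "s \<in> rel_legal G S w" for s w
    using that by (auto simp: rel_legal_def T_def)
  have nb_cur: "nb (cur w) = (\<lambda>s. cur (w @ [s])) ` T" if "set w \<subseteq> T" for w
  proof -
    have "set w \<subseteq> carrier G" using that T by auto
    then have "cur (w @ [s]) = \<phi> (word_value G w \<otimes> s)" if "s \<in> T" for s
      using word_value_snoc T that unfolding cur_def by auto
    then show ?thesis
      using nb word_value_closed \<open>set w \<subseteq> carrier G\<close> unfolding cur_def T_def[symmetric] by simp
  qed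
  \<comment> \<open>Left cancellation translates the ban on undoing the last letter into the
    condition \<open>v \<noteq> p\<close> on the graph.\<close>
  have backtrack: "cur (w @ [s]) = cur (butlast w) \<longleftrightarrow> s = inv (last w)"
    if w: "set w \<subseteq> T" "w \<noteq> []" and s: "s \<in> T" for w s
  proof -
    define v where "v = word_value G (butlast w)"
    have c: "set (butlast w) \<subseteq> carrier G" "last w \<in> carrier G" "s \<in> carrier G" "v \<in> carrier G"
      using w s T word_value_closed[of "butlast w"] in_set_butlastD[of _ w] unfolding v_def
      by (auto simp: subset_iff)
    have "word_value G w = v \<otimes> last w"
      using word_value_snoc[OF c(1,2)] w(2) by (simp add: v_def)
    moreover have "word_value G (w @ [s]) = word_value G w \<otimes> s"
      using w(1) s T by (intro word_value_snoc) auto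
    ultimately have e: "word_value G (w @ [s]) = v \<otimes> (last w \<otimes> s)"
      using c by (simp add: m_assoc)
    have "cur (w @ [s]) = cur (butlast w) \<longleftrightarrow> v \<otimes> (last w \<otimes> s) = v"
      unfolding cur_def e v_def[symmetric] using inj_on_eq_iff[OF inj] c by simp
    also have "\<dots> \<longleftrightarrow> last w \<otimes> s = \<one>"
      using c by (simp add: l_cancel_one)
    also have "\<dots> \<longleftrightarrow> s = inv (last w)"
      using c by (metis inv_equality inv_inv r_inv)
    finally show ?thesis .
  qed
  \<comment> \<open>For the empty word \<open>butlast\<close> makes the start its own predecessor,
    which only narrows the choice of Player 1.\<close>
  have legal_ex: "\<exists>s\<in>rel_legal G S w. cur (w @ [s]) = v"
    if "set w \<subseteq> T" "v \<in> nb (cur w)" "v \<noteq> cur (butlast w)" for w v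
    using that nb_cur backtrack unfolding rel_legal_def T_def[symmetric] by auto
  have legal_nb: "cur (w @ [s]) \<in> nb (cur w) \<and> cur (w @ [s]) \<noteq> cur (butlast w)"
    if "set w \<subseteq> T" "w \<noteq> []" "s \<in> rel_legal G S w" for w s
    using that nb_cur[of w] backtrack[of w s] legal_T[of s w] unfolding rel_legal_def by auto
  have returns: "rel_returns G (w @ [s]) \<longleftrightarrow> cur (w @ [s]) \<in> visited G \<phi> w"
    if "set w \<subseteq> T" "s \<in> T" for w s
    using rel_returns_snoc_iff[OF inj, of w s] that T unfolding cur_def by auto
  have good_ex: "\<exists>s. good w s" if w: "set w \<subseteq> T" and "F w" for w
    using \<open>F w\<close>[unfolded F_def]
  proof cases
    case (close v)
    then obtain s where s: "s \<in> rel_legal G S w" "cur (w @ [s]) = v"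
      using legal_ex w by blast
    then show ?thesis
      using returns[OF w legal_T[OF s(1)]] close unfolding good_def by auto
  next
    case (advance v)
    then obtain s where s: "s \<in> rel_legal G S w" "cur (w @ [s]) = v"
      using legal_ex w by blast
    have ws: "set (w @ [s]) \<subseteq> T"
      using w legal_T[OF s(1)] by simp
    have vis: "visited G \<phi> (w @ [s]) = insert v (visited G \<phi> w)"
      using s(2) by (simp add: visited_snoc cur_def)
    have "\<not> rel_returns G (w @ [s, t]) \<and> F (w @ [s, t])"
      if t: "t \<in> rel_legal G S (w @ [s])" for t
    proof -
      let ?u = "cur ((w @ [s]) @ [t])"
      have u: "?u \<in> nb v" "?u \<noteq> cur w"
        using legal_nb[OF ws _ t] s(2) by auto
      then have "\<not> rel_returns G ((w @ [s]) @ [t])"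
        using returns[OF ws legal_T[OF t]] advance(3) vis by auto
      moreover have "F ((w @ [s]) @ [t])"
        using advance(4)[OF u] vis s(2)
        unfolding F_def visited_snoc[of _ _ "w @ [s]"] cur_def[symmetric]
        by (simp add: butlast_append)
      ultimately show ?thesis by simp
    qed
    then show ?thesis
      using s(1) unfolding good_def by blast
  qed
  define \<sigma> where "\<sigma> w = (SOME s. good w s)" for w
  have \<sigma>: "good w (\<sigma> w)" if "set w \<subseteq> T" "F w" for w
    unfolding \<sigma>_def using good_ex[OF that] by (rule someI_ex)
  have play_T: "set w \<subseteq> T" if "rel_play G S w" for w
    using that legal_T unfolding rel_play_def by (metis in_set_conv_nth subsetI)
  have play_prefix: "rel_play G S (take k w)" if "rel_play G S w" for k w
    using that unfolding rel_play_def by (simp add: min_def)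
  have follows_prefix: "follows_strategy Player1 \<sigma> (take k w)"
    if "follows_strategy Player1 \<sigma> w" for k w
    using that unfolding follows_strategy_def by (simp add: min_def)
  have inv: "\<not> rel_returns G w \<and> F w"
    if "rel_play G S w" "follows_strategy Player1 \<sigma> w" "length w = 2 * m" for w m
    using that
  proof (induction m arbitrary: w)
    case 0
    then show ?case
      using wins by (simp add: rel_returns_def F_def visited_def cur_def word_value_def)
  next
    case (Suc m)
    define v where "v = take (2 * m) w"
    have v: "set v \<subseteq> T" "F v"
      using Suc.IH[of v] play_prefix follows_prefix play_T Suc.prems unfolding v_def by auto
    have tm: "to_move v = Player1"
      using Suc.prems(3) unfolding to_move_def v_def by simp
    have s: "w ! (2 * m) = \<sigma> v"
      using Suc.prems tm unfolding follows_strategy_def v_def by simp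
    define t where "t = w ! Suc (2 * m)"
    have w1: "take (Suc (2 * m)) w = v @ [\<sigma> v]"
      using Suc.prems(3) s unfolding v_def by (simp add: take_Suc_conv_app_nth)
    have w2: "w = v @ [\<sigma> v, t]"
      using Suc.prems(3) w1 take_Suc_conv_app_nth[of "Suc (2 * m)" w] unfolding t_def by simp
    \<comment> \<open>Play went on after the move of Player 1, so that move did not return and the
      second alternative of \<open>good\<close> applies.\<close>
    have "\<not> rel_over G S (take (Suc (2 * m)) w) \<and>
        w ! Suc (2 * m) \<in> rel_legal G S (take (Suc (2 * m)) w)"
      using Suc.prems unfolding rel_play_def by auto
    then show ?case
      using \<sigma>[OF v] w2 unfolding good_def rel_over_def w1 t_def[symmetric] by metis
  qed
  have "(rel_over G S w \<longrightarrow> rel_winner w = Player1) \<and>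
      (\<not> rel_over G S w \<and> to_move w = Player1 \<longrightarrow> \<sigma> w \<in> rel_legal G S w)"
    if w: "rel_play G S w" "follows_strategy Player1 \<sigma> w" for w
  proof (cases "even (length w)")
    case True
    then obtain m where "length w = 2 * m" by blast
    then have "\<not> rel_returns G w \<and> F w" using inv w by blast
    then show ?thesis
      using \<sigma>[OF play_T[OF w(1)]] unfolding good_def rel_over_def by auto
  next
    \<comment> \<open>At odd length Player 1 moved last, and so wins whichever way the game ends
      there.\<close>
    case False
    then show ?thesis by (simp add: rel_winner_def to_move_def)
  qed
  then have "winning_strategy G S Player1 \<sigma>"
    unfolding winning_strategy_def using infinite_play_impossible[OF fin S] by blast
  then show ?thesis
    unfolding has_winning_strategy_def by blast
qed

end


section \<open>The Cayley graph of the dicyclic group\<close>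

text \<open>The vertex \<open>(c, h, l)\<close> with \<open>c < n\<close> stands for \<open>a\<^sup>i x\<^sup>l\<close>, where \<open>i = c + n h\<close>.  Multiplying by
  \<open>x\<close> or its inverse leads from \<open>(c, h, l)\<close> to the two vertices \<open>(c, _, \<not> l)\<close>.\<close>

type_synonym vertex = "nat \<times> bool \<times> bool"

text \<open>Exponents of \<open>a\<close> count modulo \<open>2n\<close>, so crossing between
  columns \<open>n - 1\<close> and \<open>0\<close> toggles \<open>h\<close>.\<close>

fun right :: "nat \<Rightarrow> vertex \<Rightarrow> vertex" where
  "right n (c, h, l) = (if Suc c < n then (Suc c, h, l) else (0, \<not> h, l))"

fun left :: "nat \<Rightarrow> vertex \<Rightarrow> vertex" where
  "left n (c, h, l) = (if c = 0 then (n - 1, \<not> h, l) else (c - 1, h, l))"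

text \<open>This is right multiplication by a letter: \<open>x a = (inv a) x\<close> reverses the
  direction on the layer of \<open>x\<close>, while \<open>x x = a^n\<close> and
  \<open>inv x = a^n x\<close> account for the toggles of \<open>h\<close>.\<close>

fun dic_step :: "nat \<Rightarrow> dic_gen letter \<Rightarrow> vertex \<Rightarrow> vertex" where
  "dic_step n (Gen DicA) (c, h, l) = (if l then left n (c, h, l) else right n (c, h, l))"
| "dic_step n (GenInv DicA) (c, h, l) = (if l then right n (c, h, l) else left n (c, h, l))"
| "dic_step n (Gen DicX) (c, h, l) = (c, h \<noteq> l, \<not> l)"
| "dic_step n (GenInv DicX) (c, h, l) = (c, h = l, \<not> l)"

definition dic_nb :: "nat \<Rightarrow> vertex \<Rightarrow> vertex set" where
  "dic_nb n v = range (\<lambda>s. dic_step n s v)"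

lemma UNIV_dic_letter:
  "(UNIV :: dic_gen letter set) = {Gen DicA, GenInv DicA, Gen DicX, GenInv DicX}"
proof -
  have "s \<in> {Gen DicA, GenInv DicA, Gen DicX, GenInv DicX}" for s
    by (cases s; cases "case s of Gen g \<Rightarrow> g | GenInv g \<Rightarrow> g") auto
  then show ?thesis by blast
qed

lemma dic_nb_eq:
  "dic_nb n (c, h, l) = {right n (c, h, l), left n (c, h, l), (c, False, \<not> l), (c, True, \<not> l)}"
  unfolding dic_nb_def UNIV_dic_letter by (cases h; cases l) auto

lemma dic_step_less: "fst v < n \<Longrightarrow> fst (dic_step n s v) < n"
  by (cases "(n, s, v)" rule: dic_step.cases) auto

lemma fold_dic_step_less: "fst v < n \<Longrightarrow> fst (fold (dic_step n) u v) < n"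
  by (induction u arbitrary: v) (auto simp: dic_step_less)

lemma dic_step_DicA_funpow:
  assumes "c < n" "k \<le> n"
  shows "(dic_step n (Gen DicA) ^^ k) (c, h, l) =
    (if l then (if k \<le> c then (c - k, h, l) else (c + n - k, \<not> h, l))
     else (if c + k < n then (c + k, h, l) else (c + k - n, \<not> h, l)))"
  using assms(2)
proof (induction k)
  case 0
  then show ?case using assms(1) by simp
next
  case (Suc k)
  then show ?case using assms(1) by (cases l) (auto simp: Suc_diff_le)
qed

lemma dic_step_DicA_funpow_n:
  "c < n \<Longrightarrow> (dic_step n (Gen DicA) ^^ n) (c, h, l) = (c, \<not> h, l)"
  using dic_step_DicA_funpow[of c n n] by simp

text \<open>Both sides of each relation act alike on the vertices, so the vertex reached by a word
  depends only on its class. This is what keeps the presented group from collapsing.\<close>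

lemma fold_dic_step_cong:
  "pres_eq (dic_relations n) u v \<Longrightarrow> fst p < n \<Longrightarrow>
    fold (dic_step n) u p = fold (dic_step n) v p"
proof (induction arbitrary: p rule: pres_eq.induct)
  case (relation u v)
  obtain c h l where p: "p = (c, h, l)" by (cases p)
  show ?case
    using relation dic_step_DicA_funpow_n[of c n] unfolding dic_relations_def p
    by (auto simp: fold_replicate funpow_add mult_2)
next
  case (cancel_right g)
  obtain c h l where p: "p = (c, h, l)" by (cases p)
  show ?case using cancel_right unfolding p by (cases g) auto
next
  case (cancel_left g)
  obtain c h l where p: "p = (c, h, l)" by (cases p)
  show ?case using cancel_left unfolding p by (cases g) auto
next
  case (append u u' v v')
  then show ?case using fold_dic_step_less by simp
qed auto

section \<open>Normal forms of the group elements\<close>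

definition dic_elem :: "nat \<Rightarrow> vertex \<Rightarrow> dic_gen letter list set" where
  "dic_elem n = (\<lambda>(c, h, l). dic_a n [^]\<^bsub>Dic n\<^esub> (c + (if h then n else 0)) \<otimes>\<^bsub>Dic n\<^esub>
     (if l then dic_x n else \<one>\<^bsub>Dic n\<^esub>))"

abbreviation dic_class :: "nat \<Rightarrow> dic_gen letter list \<Rightarrow> dic_gen letter list set" where
  "dic_class n \<equiv> pres_class (dic_relations n)"

lemma group_Dic: "group (Dic n)"
  by (simp add: Dic_def group_presented_group)

lemma dic_class_closed: "dic_class n u \<in> carrier (Dic n)"
  by (simp add: Dic_def presented_group_def)

lemma carrier_Dic: "carrier (Dic n) = range (dic_class n)"
  by (simp add: Dic_def presented_group_def)

lemma one_Dic: "\<one>\<^bsub>Dic n\<^esub> = dic_class n []"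
  by (simp add: Dic_def presented_group_def)

lemma dic_class_append: "dic_class n (u @ v) = dic_class n u \<otimes>\<^bsub>Dic n\<^esub> dic_class n v"
  by (simp add: Dic_def presented_group_mult)

lemma dic_class_GenInv: "dic_class n [GenInv g] = inv\<^bsub>Dic n\<^esub> dic_class n [Gen g]"
proof -
  interpret group "Dic n" by (rule group_Dic)
  have "dic_class n [GenInv g] \<otimes>\<^bsub>Dic n\<^esub> dic_class n [Gen g] = \<one>\<^bsub>Dic n\<^esub>"
    by (simp flip: dic_class_append add: one_Dic pres_class_eq_iff pres_eq.cancel_left)
  then show ?thesis
    using inv_equality dic_class_closed by metis
qed

lemma dic_class_replicate:
  "dic_class n (replicate k (Gen DicA)) = dic_a n [^]\<^bsub>Dic n\<^esub> k"
proof (induction k)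
  case 0
  then show ?case by (simp add: one_Dic)
next
  case (Suc k)
  have "replicate (Suc k) (Gen DicA) = replicate k (Gen DicA) @ [Gen DicA]"
    by (simp add: replicate_append_same)
  then show ?case
    using Suc by (simp add: dic_class_append dic_a_def del: replicate_Suc)
qed

text \<open>The relations bring a normal form followed by one letter back to normal form. Hence
  every class has one, found by walking along its word.\<close>

lemma dic_elem_mult:
  assumes "fst v < n"
  shows "dic_elem n v \<otimes>\<^bsub>Dic n\<^esub> dic_class n [s] = dic_elem n (dic_step n s v)"
proof -
  interpret group "Dic n" by (rule group_Dic)
  let ?a = "dic_a n" and ?x = "dic_x n"
  have a: "?a \<in> carrier (Dic n)" and x: "?x \<in> carrier (Dic n)"
    by (simp_all add: dic_a_def dic_x_def dic_class_closed)
  have rel: "dic_class n u = dic_class n v" if "(u, v) \<in> dic_relations n" for u v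
    using that by (simp add: pres_class_eq_iff pres_eq.relation)
  have a2n: "?a [^]\<^bsub>Dic n\<^esub> (2 * n) = \<one>\<^bsub>Dic n\<^esub>"
    using rel[of "replicate (2 * n) (Gen DicA)" "[]"]
    unfolding dic_class_replicate one_Dic by (simp add: dic_relations_def)
  have xx: "?x \<otimes>\<^bsub>Dic n\<^esub> ?x = ?a [^]\<^bsub>Dic n\<^esub> n"
    using rel[of "[Gen DicX, Gen DicX]" "replicate n (Gen DicA)"]
    unfolding dic_class_replicate dic_x_def dic_class_append[symmetric]
    by (simp add: dic_relations_def)
  have "inv\<^bsub>Dic n\<^esub> ?x \<otimes>\<^bsub>Dic n\<^esub> (?a \<otimes>\<^bsub>Dic n\<^esub> ?x) = inv\<^bsub>Dic n\<^esub> ?a"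
    using rel[of "[GenInv DicX, Gen DicA, Gen DicX]" "[GenInv DicA]"]
    unfolding dic_x_def dic_a_def dic_class_GenInv[symmetric] dic_class_append[symmetric]
    by (simp add: dic_relations_def)
  then have ax: "?a \<otimes>\<^bsub>Dic n\<^esub> ?x = ?x \<otimes>\<^bsub>Dic n\<^esub> inv\<^bsub>Dic n\<^esub> ?a"
    using a x by (simp add: inv_solve_left')
  then have xa: "?x \<otimes>\<^bsub>Dic n\<^esub> ?a = inv\<^bsub>Dic n\<^esub> ?a \<otimes>\<^bsub>Dic n\<^esub> ?x"
    using a x by (metis inv_closed inv_solve_left inv_solve_right m_assoc m_closed)
  have xinv: "inv\<^bsub>Dic n\<^esub> ?x = ?a [^]\<^bsub>Dic n\<^esub> n \<otimes>\<^bsub>Dic n\<^esub> ?x"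
  proof (rule inv_equality)
    show "?a [^]\<^bsub>Dic n\<^esub> n \<otimes>\<^bsub>Dic n\<^esub> ?x \<otimes>\<^bsub>Dic n\<^esub> ?x = \<one>\<^bsub>Dic n\<^esub>"
      using a x a2n by (simp add: m_assoc xx nat_pow_mult mult_2)
  qed (use a x in auto)
  obtain c h l where v: "v = (c, h, l)" by (cases v)
  define e where "e = (\<lambda>(c, h). ?a [^]\<^bsub>Dic n\<^esub> (c + (if h then n else 0)))"
  have e: "e q \<in> carrier (Dic n)" for q
    using a by (simp add: e_def case_prod_beta)
  have elem: "dic_elem n (c, h, l) = e (c, h) \<otimes>\<^bsub>Dic n\<^esub> (if l then ?x else \<one>\<^bsub>Dic n\<^esub>)"
    for c h l
    by (simp add: dic_elem_def e_def)
  have flip: "e (c, h) \<otimes>\<^bsub>Dic n\<^esub> ?a [^]\<^bsub>Dic n\<^esub> n = e (c, \<not> h)" for c h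
  proof (cases h)
    case True
    have "?a [^]\<^bsub>Dic n\<^esub> (c + 2 * n) = ?a [^]\<^bsub>Dic n\<^esub> c"
      using a by (simp add: a2n flip: nat_pow_mult)
    then show ?thesis
      using a True by (simp add: e_def nat_pow_mult mult_2 add.assoc)
  qed (use a in \<open>simp add: e_def nat_pow_mult\<close>)
  have up: "e (c, h) \<otimes>\<^bsub>Dic n\<^esub> ?a = (if Suc c < n then e (Suc c, h) else e (0, \<not> h))"
    if "c < n" for c h
  proof -
    have "e (c, h) \<otimes>\<^bsub>Dic n\<^esub> ?a = e (Suc c, h)"
      by (simp add: e_def)
    moreover have "e (n, h) = e (0, \<not> h)"
      using flip[of 0 h] a by (cases h) (simp_all add: e_def nat_pow_mult)
    ultimately show ?thesis
      using that by (cases "Suc c < n") (simp_all add: Suc_lessI not_less_eq less_Suc_eq)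
  qed
  have down: "e (c, h) \<otimes>\<^bsub>Dic n\<^esub> inv\<^bsub>Dic n\<^esub> ?a = (if c = 0 then e (n - 1, \<not> h) else e (c - 1, h))"
    if "c < n" for c h
  proof (rule inv_solve_right'[THEN iffD2])
    show "e (c, h) = (if c = 0 then e (n - 1, \<not> h) else e (c - 1, h)) \<otimes>\<^bsub>Dic n\<^esub> ?a"
      using up[of "n - 1" "\<not> h"] up[of "c - 1" h] that by auto
  qed (use a e in auto)
  have s: "dic_class n [Gen DicA] = ?a" "dic_class n [Gen DicX] = ?x"
    "dic_class n [GenInv DicA] = inv\<^bsub>Dic n\<^esub> ?a" "dic_class n [GenInv DicX] = inv\<^bsub>Dic n\<^esub> ?x"
    by (simp_all add: dic_class_GenInv dic_a_def dic_x_def)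
  have "c < n" using assms v by simp
  \<comment> \<open>Moving letters past \<open>x\<close> reduces every case to \<open>up\<close>,
    \<open>down\<close> or at most a toggle of \<open>h\<close>.\<close>
  have layer:
    "e (c, h) \<otimes>\<^bsub>Dic n\<^esub> ?x \<otimes>\<^bsub>Dic n\<^esub> ?a = e (c, h) \<otimes>\<^bsub>Dic n\<^esub> inv\<^bsub>Dic n\<^esub> ?a \<otimes>\<^bsub>Dic n\<^esub> ?x"
    "e (c, h) \<otimes>\<^bsub>Dic n\<^esub> ?x \<otimes>\<^bsub>Dic n\<^esub> inv\<^bsub>Dic n\<^esub> ?a = e (c, h) \<otimes>\<^bsub>Dic n\<^esub> ?a \<otimes>\<^bsub>Dic n\<^esub> ?x"
    "e (c, h) \<otimes>\<^bsub>Dic n\<^esub> ?x \<otimes>\<^bsub>Dic n\<^esub> ?x = e (c, \<not> h)"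
    "e (c, h) \<otimes>\<^bsub>Dic n\<^esub> ?x \<otimes>\<^bsub>Dic n\<^esub> inv\<^bsub>Dic n\<^esub> ?x = e (c, h)"
    "e (c, h) \<otimes>\<^bsub>Dic n\<^esub> inv\<^bsub>Dic n\<^esub> ?x = e (c, \<not> h) \<otimes>\<^bsub>Dic n\<^esub> ?x"
    subgoal using a x e by (simp add: m_assoc xa)
    subgoal using a x e by (simp add: m_assoc ax)
    subgoal using a x e by (simp add: m_assoc xx flip)
    subgoal using a x e by (simp add: m_assoc)
    subgoal using a x e by (simp add: xinv m_assoc flip: flip)
    done
  have "s \<in> {Gen DicA, GenInv DicA, Gen DicX, GenInv DicX}"
    using UNIV_dic_letter by blast
  then show ?thesis
    unfolding v using \<open>c < n\<close> up[of c h] down[of c h] layer e x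
    by (cases l) (auto simp: s elem)
qed

lemma dic_class_eq_dic_elem:
  assumes "0 < n"
  shows "dic_class n u = dic_elem n (fold (dic_step n) u (0, False, False))"
proof (induction u rule: rev_induct)
  case Nil
  interpret group "Dic n" by (rule group_Dic)
  show ?case by (simp add: dic_elem_def one_Dic[symmetric])
next
  case (snoc s u)
  then show ?case
    using dic_elem_mult[OF fold_dic_step_less] assms by (simp add: dic_class_append)
qed

text \<open>\<open>SOME\<close> picks an arbitrary representing word; the endpoint is independent of
  it by \<open>fold_dic_step_cong\<close>.\<close>

definition dic_vertex :: "nat \<Rightarrow> dic_gen letter list set \<Rightarrow> vertex" where
  "dic_vertex n A = fold (dic_step n) (SOME u. dic_class n u = A) (0, False, False)"

lemma dic_vertex_class:
  assumes "0 < n"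
  shows "dic_vertex n (dic_class n u) = fold (dic_step n) u (0, False, False)"
proof -
  have "dic_class n (SOME v. dic_class n v = dic_class n u) = dic_class n u"
    by (rule someI) simp
  then show ?thesis
    unfolding dic_vertex_def pres_class_eq_iff using fold_dic_step_cong assms by simp
qed

lemma inj_on_dic_vertex: "0 < n \<Longrightarrow> inj_on (dic_vertex n) (carrier (Dic n))"
  unfolding carrier_Dic by (rule inj_onI) (metis dic_class_eq_dic_elem dic_vertex_class rangeE)

lemma finite_carrier_Dic:
  assumes "0 < n"
  shows "finite (carrier (Dic n))"
proof (rule inj_on_finite[OF inj_on_dic_vertex[OF assms]])
  show "dic_vertex n ` carrier (Dic n) \<subseteq> {..<n} \<times> UNIV"
    using fold_dic_step_less[of "(0, False, False)" n] assms
    by (simp add: carrier_Dic dic_vertex_class mem_Times_iff image_subset_iff)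
qed simp

lemma dic_letters:
  "{dic_a n, dic_x n} \<union> (\<lambda>t. inv\<^bsub>Dic n\<^esub> t) ` {dic_a n, dic_x n} = range (\<lambda>s. dic_class n [s])"
  unfolding UNIV_dic_letter by (auto simp: dic_a_def dic_x_def dic_class_GenInv)

lemma dic_nb_dic_vertex:
  assumes "0 < n" "g \<in> carrier (Dic n)"
  shows "dic_nb n (dic_vertex n g) = (\<lambda>s. dic_vertex n (g \<otimes>\<^bsub>Dic n\<^esub> s)) `
    ({dic_a n, dic_x n} \<union> (\<lambda>t. inv\<^bsub>Dic n\<^esub> t) ` {dic_a n, dic_x n})"
proof -
  obtain u where "g = dic_class n u" using assms(2) unfolding carrier_Dic by blast
  then show ?thesis
    unfolding dic_letters dic_nb_def
    by (simp add: image_image dic_vertex_class[OF assms(1)] flip: dic_class_append)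
qed


section \<open>The strategy\<close>

text \<open>Player 1 is to move at \<open>(k, g, True)\<close> and retreats towards column \<open>d\<close>, in parallel to the
  vertices \<open>(j, \<not> g, True)\<close> that were visited on the way out.\<close>

lemma mover_wins_retreat:
  assumes "d \<le> k" "even (k - d)" "0 < d" "Suc k < n" "(d, h, False) \<in> V"
    "d < k \<Longrightarrow> (d, g, True) \<notin> V"
    "\<And>j g' l'. d < j \<Longrightarrow> j < k \<Longrightarrow> (j, g', l') \<in> V \<longleftrightarrow> g' = (\<not> g) \<and> l'"
  shows "mover_wins (dic_nb n) V (Suc k, g, True) (k, g, True)"
  using assms
proof (induction "k - d" arbitrary: k V rule: less_induct)
  case less
  show ?case
  proof (cases "k = d")
    case True
    then show ?thesis
      using less.prems by (intro mover_wins.close[of "(d, h, False)"]) (cases h, auto simp: dic_nb_eq)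
  next
    case False
    have "k - d \<noteq> 1" using less.prems(2) odd_one by metis
    then have "k = Suc (Suc (k - 2))" "d \<le> k - 2" "even (k - 2 - d)"
      using False less.prems(1,2) by auto
    then obtain m where k: "k = Suc (Suc m)" "d \<le> m" "even (m - d)" by blast
    have mid: "(Suc m, g', l') \<in> V \<longleftrightarrow> g' = (\<not> g) \<and> l'" for g' l'
      using less.prems(7)[of "Suc m"] k by simp
    have m: "(m, g, True) \<notin> V"
      using less.prems(6) less.prems(7)[of m g True] k by (cases "m = d") auto
    have nb: "dic_nb n (Suc m, g, True) =
        {(k, g, True), (m, g, True), (Suc m, False, False), (Suc m, True, False)}"
      using less.prems(4) k by (simp add: dic_nb_eq)
    show ?thesis
    \<comment> \<open>After this retreat a change of layer lets Player 1 close at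
      \<open>(Suc m, \<not> g, True)\<close>. The other reply leads to column \<open>m\<close>,
      again at even distance from \<open>d\<close>.\<close>
    proof (rule mover_wins.advance[of "(Suc m, g, True)"])
      fix u assume "u \<in> dic_nb n (Suc m, g, True)" "u \<noteq> (k, g, True)"
      then consider "u = (m, g, True)" | h' where "u = (Suc m, h', False)"
        unfolding nb by blast
      note u = this
      show "u \<notin> insert (Suc m, g, True) V"
        using u mid m by cases auto
      show "mover_wins (dic_nb n) (insert u (insert (Suc m, g, True) V)) (Suc m, g, True) u"
        using u
      proof cases
        case 1
        show ?thesis
          unfolding 1 using less.prems k by (intro less.hyps) auto
      next
        case (2 h')
        then show ?thesis
          using mid by (intro mover_wins.close[of "(Suc m, \<not> g, True)"]) (cases g, auto simp: dic_nb_eq)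
      qed
    qed (use less.prems(4) k in \<open>auto simp: dic_nb_eq\<close>)
  qed
qed

text \<open>If \<open>h\<close> holds, the step right wraps around to the origin and closes.
  Otherwise Player 1 changes the layer, and each of the three replies is adjacent to a visited
  vertex.\<close>

lemma mover_wins_last_column_even:
  assumes "3 \<le> n"
    "\<And>h' l'. (0, h', l') \<in> V \<longleftrightarrow> \<not> h' \<and> \<not> l'"
    "\<And>h' l'. (n - 2, h', l') \<in> V \<longleftrightarrow> h' = h \<and> \<not> l'"
    "\<And>h' l'. (n - 1, h', l') \<in> V \<longleftrightarrow> h' = h \<and> \<not> l'"
  shows "mover_wins (dic_nb n) V (n - 2, h, False) (n - 1, h, False)"
proof (cases h)
  case True
  then show ?thesis
    using assms by (intro mover_wins.close[of "(0, False, False)"]) (auto simp: dic_nb_eq)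
next
  case False
  have nb: "dic_nb n (n - 1, False, True) =
      {(0, True, True), (n - 2, False, True), (n - 1, False, False), (n - 1, True, False)}"
    using assms(1) by (auto simp: dic_nb_eq)
  show ?thesis
  proof (rule mover_wins.advance[of "(n - 1, False, True)"])
    fix u assume "u \<in> dic_nb n (n - 1, False, True)" "u \<noteq> (n - 1, h, False)"
    then consider "u = (0, True, True)" | "u = (n - 2, False, True)" | "u = (n - 1, True, False)"
      unfolding nb using False by blast
    note u = this
    show "u \<notin> insert (n - 1, False, True) V"
      using u assms False by cases auto
    show "mover_wins (dic_nb n) (insert u (insert (n - 1, False, True) V)) (n - 1, False, True) u"
      using u
    proof cases
      case 1
      then show ?thesis
        using assms by (intro mover_wins.close[of "(0, False, False)"]) (auto simp: dic_nb_eq)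
    next
      case 2
      then show ?thesis
        using assms False
        by (intro mover_wins.close[of "(n - 2, False, False)"]) (auto simp: dic_nb_eq)
    next
      case 3
      then show ?thesis
        using assms by (intro mover_wins.close[of "(0, False, False)"]) (auto simp: dic_nb_eq)
    qed
  qed (use assms(1) False in \<open>auto simp: dic_nb_eq\<close>)
qed

text \<open>The vertices \<open>(0, _, True)\<close> and \<open>(n - 1, True, False)\<close> are
  adjacent to the origin, so entering them loses for Player 2. What remains is the path through
  \<open>(n - 1, False, False)\<close> and \<open>(n - 1, \<not> h, True)\<close> into the
  retreat.\<close>

lemma mover_wins_last_column_odd:
  assumes n: "3 \<le> n" and d: "d \<le> n - 2" "even (n - 2 - d)" "0 < d"
    and origin: "\<And>h' l'. (0, h', l') \<in> V \<longleftrightarrow> \<not> h' \<and> \<not> l'"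
    and last: "\<And>h' l'. (n - 1, h', l') \<notin> V"
    and p: "fst p \<le> n - 2"
    and dV: "(d, h', False) \<in> V" "(d, \<not> h, True) \<notin> V"
    and run: "\<And>j g' l'. d < j \<Longrightarrow> j \<le> n - 2 \<Longrightarrow> (j, g', l') \<in> V \<longleftrightarrow> g' = h \<and> l'"
  shows "mover_wins (dic_nb n) V p (n - 2, h, True)"
proof -
  define W where "W = insert (n - 1, False, False) (insert (n - 1, h, True) V)"
  have nb: "dic_nb n (n - 1, g, True) =
      {(0, \<not> g, True), (n - 2, g, True), (n - 1, False, False), (n - 1, True, False)}" for g
    using n by (auto simp: dic_nb_eq)
  have start: "(0, False, False) \<in> V"
    using origin by simp
  \<comment> \<open>\<open>run\<close> starts only after column \<open>d\<close>, so
    \<open>d = n - 2\<close> needs the separate assumption on column \<open>d\<close>.\<close>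
  have inner: "(n - 2, \<not> h, True) \<notin> V"
    using dV(2) run[of "n - 2" "\<not> h" True] d(1) by (cases "d = n - 2") auto
  have "mover_wins (dic_nb n) W (n - 1, h, True) (n - 1, False, False)"
  proof (rule mover_wins.advance[of "(n - 1, \<not> h, True)"])
    fix u assume "u \<in> dic_nb n (n - 1, \<not> h, True)" "u \<noteq> (n - 1, False, False)"
    then consider "u = (0, h, True)" | "u = (n - 2, \<not> h, True)" | "u = (n - 1, True, False)"
      unfolding nb by auto
    note u = this
    show "u \<notin> insert (n - 1, \<not> h, True) W"
      using u origin last inner n unfolding W_def by cases auto
    show "mover_wins (dic_nb n) (insert u (insert (n - 1, \<not> h, True) W)) (n - 1, \<not> h, True) u"
      using u
    proof cases
      case 1
      then show ?thesis
        using start n by (intro mover_wins.close[of "(0, False, False)"]) (auto simp: dic_nb_eq W_def)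
    next
      case 2
      have "mover_wins (dic_nb n) (insert u (insert (n - 1, \<not> h, True) W))
          (Suc (n - 2), \<not> h, True) (n - 2, \<not> h, True)"
        using n d dV run unfolding 2 W_def
        by (intro mover_wins_retreat[of d _ _ h']) auto
      then show ?thesis
        using 2 n by (simp add: numeral_2_eq_2 Suc_diff_Suc)
    next
      case 3
      then show ?thesis
        using start n by (intro mover_wins.close[of "(0, False, False)"]) (auto simp: dic_nb_eq W_def)
    qed
  qed (auto simp: dic_nb_eq)
  note middle = this
  show ?thesis
  proof (rule mover_wins.advance[of "(n - 1, h, True)"])
    fix u assume "u \<in> dic_nb n (n - 1, h, True)" "u \<noteq> (n - 2, h, True)"
    then consider "u = (0, \<not> h, True)" | "u = (n - 1, False, False)" | "u = (n - 1, True, False)"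
      unfolding nb by auto
    note u = this
    show "u \<notin> insert (n - 1, h, True) V"
      using u origin last n by cases auto
    show "mover_wins (dic_nb n) (insert u (insert (n - 1, h, True) V)) (n - 1, h, True) u"
      using u
    proof cases
      case 2
      then show ?thesis using middle by (simp add: W_def)
    qed (use start n in \<open>auto simp: dic_nb_eq intro!: mover_wins.close[of "(0, False, False)"]\<close>)
  qed (use n p in \<open>auto simp: dic_nb_eq\<close>)
qed

text \<open>Player 2 is the only one to change the layer before the last column; \<open>d\<close> is the column of
  the last change.  Each change alters the parity of the column in which Player 1 is to move, so
  that this column is even exactly on the layer of the origin.\<close>

lemma mover_wins_march:
  assumes n: "odd n" "3 \<le> n" and c: "c \<le> n - 2" and l: "l \<longleftrightarrow> odd c"
    and d: "d \<le> c" "even (c - d)"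
    and bound: "\<And>v. v \<in> V \<Longrightarrow> fst v \<le> c"
    and p: "fst p \<le> c"
    and origin: "\<And>h' l'. (0, h', l') \<in> V \<longleftrightarrow> \<not> h' \<and> \<not> l'"
    and change: "l \<Longrightarrow> (d, r, False) \<in> V \<and> (d, \<not> h, True) \<notin> V"
    and run: "\<And>j g' l'. d < j \<Longrightarrow> j \<le> c \<Longrightarrow> (j, g', l') \<in> V \<longleftrightarrow> g' = h \<and> l' = l"
  shows "mover_wins (dic_nb n) V p (c, h, l)"
  using c l d bound p origin change run
proof (induction "n - c" arbitrary: c d h r l p V rule: less_induct)
  case less
  have new: "(j, g, m) \<notin> V" if "c < j" for j g m
    using less.prems(5)[of "(j, g, m)"] that by auto
  show ?case
  proof (cases "c = n - 2")
    case True
    then have "l" using less.prems(2) n by auto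
    \<comment> \<open>\<open>d\<close> has the parity of the odd column \<open>c\<close>.\<close>
    moreover have "0 < d"
      using \<open>l\<close> less.prems by (metis diff_zero gr0I)
    ultimately show ?thesis
      using mover_wins_last_column_odd[where h' = r and d = d] less.prems new n True by simp
  next
    case False
    then have c: "Suc (Suc c) < n" using less.prems(1) n by simp
    have nb: "dic_nb n (Suc c, h, l) =
        {(Suc (Suc c), h, l), (c, h, l), (Suc c, False, \<not> l), (Suc c, True, \<not> l)}"
      using c by (simp add: dic_nb_eq)
    show ?thesis
    proof (rule mover_wins.advance[of "(Suc c, h, l)"])
      fix u assume "u \<in> dic_nb n (Suc c, h, l)" "u \<noteq> (c, h, l)"
      then consider "u = (Suc (Suc c), h, l)" | h' where "u = (Suc c, h', \<not> l)"
        unfolding nb by blast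
      note u = this
      let ?V = "insert u (insert (Suc c, h, l) V)"
      show "u \<notin> insert (Suc c, h, l) V"
        using u new by cases auto
      show "mover_wins (dic_nb n) ?V (Suc c, h, l) u"
        using u
      proof cases
        case 1
        have run': "(j, g', l') \<in> ?V \<longleftrightarrow> g' = h \<and> l' = l" if "d < j" "j \<le> Suc (Suc c)" for j g' l'
          using less.prems(3) less.prems(9)[of j] new[of j] that unfolding 1
          by (cases "j \<le> c") (auto simp: le_Suc_eq)
        show ?thesis
        proof (cases "Suc (Suc c) = n - 1")
          case True
          \<comment> \<open>Here \<open>c = n - 3\<close> is even, so play is on the layer of the
            origin.\<close>
          then have m: "n = c + 3" using n by simp
          then have "\<not> l" using less.prems(2) n by simp
          have "mover_wins (dic_nb n) ?V (n - 2, h, False) (n - 1, h, False)"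
            by (rule mover_wins_last_column_even)
              (use n less.prems(7) new m \<open>\<not> l\<close> in \<open>auto simp: 1\<close>)
          then show ?thesis
            using m \<open>\<not> l\<close> by (simp add: 1)
        next
          case False
          have bound': "fst v \<le> Suc (Suc c)" if "v \<in> ?V" for v
            using that less.prems(5) unfolding 1 by fastforce
          have origin': "(0, h', l') \<in> ?V \<longleftrightarrow> \<not> h' \<and> \<not> l'" for h' l'
            using less.prems(7) unfolding 1 by simp
          have change': "(d, r, False) \<in> ?V \<and> (d, \<not> h, True) \<notin> ?V" if l
            using less.prems(3,8) that unfolding 1 by simp
          have "n - Suc (Suc c) < n - c" "Suc (Suc c) \<le> n - 2" "l \<longleftrightarrow> odd (Suc (Suc c))"
            "d \<le> Suc (Suc c)" "even (Suc (Suc c) - d)" "fst (Suc c, h, l) \<le> Suc (Suc c)"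
            using c False less.prems(2-4) by (simp_all add: Suc_diff_le)
          note facts = this
          show ?thesis
            using less.hyps[OF facts(1-5) bound' facts(6) origin' change' run'] unfolding 1 by blast
        qed
      next
        \<comment> \<open>The change of layer restarts the run with \<open>d = Suc c\<close>, so the
          run condition is vacuous. If the new layer is that of \<open>x\<close>, the vertex just
          left supplies \<open>r = h\<close>.\<close>
        case (2 h')
        have bound': "fst v \<le> Suc c" if "v \<in> ?V" for v
          using that less.prems(5) unfolding 2 by fastforce
        have origin': "(0, g, l') \<in> ?V \<longleftrightarrow> \<not> g \<and> \<not> l'" for g l'
          using less.prems(7) unfolding 2 by simp
        have change': "(Suc c, h, False) \<in> ?V \<and> (Suc c, \<not> h', True) \<notin> ?V" if "\<not> l"
          using new that unfolding 2 by simp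
        have run': "(j, g, l') \<in> ?V \<longleftrightarrow> g = h' \<and> l' = (\<not> l)" if "Suc c < j" "j \<le> Suc c" for j g l'
          using that by simp
        have "n - Suc c < n - c" "Suc c \<le> n - 2" "(\<not> l) = odd (Suc c)"
          "Suc c \<le> Suc c" "even (Suc c - Suc c)" "fst (Suc c, h, l) \<le> Suc c"
          using c less.prems(2) by simp_all
        note facts = this
        show ?thesis
          using less.hyps[OF facts(1-5) bound' facts(6) origin' change' run'] unfolding 2 by blast
      qed
    qed (use less.prems c in \<open>auto simp: dic_nb_eq\<close>)
  qed
qed

theorem theorem4p3:
  fixes n :: nat
  assumes "odd n" and "n \<ge> 3"
  shows "has_winning_strategy (Dic n) {dic_a n, dic_x n} Player1"
proof -
  interpret group "Dic n" by (rule group_Dic)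
  have n: "0 < n" using assms(2) by simp
  have v: "dic_vertex n \<one>\<^bsub>Dic n\<^esub> = (0, False, False)"
    "dic_vertex n (dic_a n) = (1, False, False)" "dic_vertex n (dic_x n) = (0, False, True)"
    using dic_vertex_class[OF n] assms(2) by (simp_all add: one_Dic dic_a_def dic_x_def)
  show ?thesis
  proof (rule has_winning_strategy_Player1I[OF finite_carrier_Dic[OF n] _ _
        inj_on_dic_vertex[OF n] dic_nb_dic_vertex[OF n]])
    show "{dic_a n, dic_x n} \<subseteq> carrier (Dic n)"
      by (simp add: dic_a_def dic_x_def dic_class_closed)
    show "\<one>\<^bsub>Dic n\<^esub> \<notin> {dic_a n, dic_x n}"
      using v by auto
    show "mover_wins (dic_nb n) {dic_vertex n \<one>\<^bsub>Dic n\<^esub>} (dic_vertex n \<one>\<^bsub>Dic n\<^esub>)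
        (dic_vertex n \<one>\<^bsub>Dic n\<^esub>)"
      \<comment> \<open>With \<open>c = d = 0\<close> on the layer of the origin, the conditions on
        the run and on the last change are void.\<close>
      unfolding v using assms by (intro mover_wins_march[where d = 0]) auto
  qed
qed

end
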